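(* There exists an infinite family of (pairwise non-isomorphic) $3$-graphs $F$ that violate the Gerbner–Tompkins–Zhou prediction. That is, each $F$ in the family satisfies $\chi(F)=2$ and $q(F)<\infty$, and there is an integer $s\ge q(F)$ for which the asymptotic equality (as $n\to\infty$) $$\mathrm{ex}(n,\{F,M_{s+1}^3\})=\max\{|E(H_i)|: 1\le i\le q(F)\}+o(n^2)$$ fails.
   Context: A $3$-graph is a $3$-uniform hypergraph. For a family $\mathcal{F}$ of $3$-graphs, $\mathrm{ex}(n,\mathcal{F})$ is the maximum number of edges in an $n$-vertex $3$-graph containing no member of $\mathcal{F}$ as a (not necessarily induced) subgraph. $M_{s+1}^3$ is the $3$-graph consisting of $s+1$ pairwise disjoint edges. $\chi(F)$ is the minimum number of colors in a vertex coloring of $F$ with no monochromatic edge. For a $3$-graph $F$ with $\chi(F)=2$, a strong red–blue coloring of $F$ is a coloring of its vertices with red and blue in which every edge contains exactly one red vertex. $q(F)$ is the minimum number of red vertices over all strong red–blue colorings of $F$, with $q(F)=\infty$ if none exists. The link graph $L_F(v)$ of $v\in V(F)$ is the graph on $V(F)\setminus\{v\}$ whose edges are the pairs $\{x,y\}$ with $\{v,x,y\}\in E(F)$. $T(m,k)$ is the Turán graph: the complete $k$-partite graph on $m$ vertices with part sizes differing by at most $1$ (so $T(m,1)$ has no edges). The $3$-graphs $H_i$ (depending on $F$, $s$, $n$, where $q(F)\le s$): order the vertices of $F$ as $1,2,\dots,|V(F)|$ so that $\chi(L_F(1))\ge\chi(L_F(2))\ge\cdots\ge\chi(L_F(|V(F)|))$.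 For $1\le i\le q(F)$ put $\ell_i=\chi(L_F(i))$. Let $A_1,A_2,B$ be pairwise disjoint sets with $|A_1|=i-1$, $|A_2|=s-(i-1)$, $|B|=n-s$, and place a copy of $T(n-s,\ell_i-1)$ on $B$. Then $H_i$ is the $3$-graph on $A_1\cup A_2\cup B$ whose edges are (1) all triples with one vertex in $A_1$ and two vertices in $B$, and (2) all triples consisting of one vertex of $A_2$ together with the two endpoints of an edge of the copy of $T(n-s,\ell_i-1)$ on $B$. The Gerbner–Tompkins–Zhou conjecture asserts that for every $3$-graph $F$ with $\chi(F)=2$ and every $s\ge q(F)$, the displayed asymptotic equality holds for $n$ sufficiently large. *)

theory Defs
  imports Complex_Main "HOL-Library.Extended_Nat" "HOL-Library.Multiset"
    "HOL-Library.Landau_Symbols"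
begin

record 'a hypergraph =
  verts :: "'a set"
  edges :: "'a set set"

definition three_graph :: "'a hypergraph \<Rightarrow> bool" where
  "three_graph H \<longleftrightarrow> finite (verts H) \<and> (\<forall>e\<in>edges H. e \<subseteq> verts H \<and> card e = 3)"

definition hg_isomorphic :: "'a hypergraph \<Rightarrow> 'b hypergraph \<Rightarrow> bool" where
  "hg_isomorphic F G \<longleftrightarrow>
     (\<exists>f. bij_betw f (verts F) (verts G) \<and> (\<lambda>e. f ` e) ` edges F = edges G)"

definition contains_copy :: "'b hypergraph \<Rightarrow> 'a hypergraph \<Rightarrow> bool" where
  "contains_copy H F \<longleftrightarrow>
     (\<exists>f. inj_on f (verts F) \<and> f ` verts F \<subseteq> verts H \<and> (\<forall>e\<in>edges F. f ` e \<in> edges H))"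

text \<open>The vertices of the host hypergraphs are natural numbers, which loses nothing
  as they are finite.\<close>

definition turan_ex :: "nat \<Rightarrow> 'a hypergraph set \<Rightarrow> nat" where
  "turan_ex n \<F> = Max {card (edges H) | H :: nat hypergraph.
     three_graph H \<and> card (verts H) = n \<and> (\<forall>F\<in>\<F>. \<not> contains_copy H F)}"

definition matching_3graph :: "nat \<Rightarrow> nat hypergraph" where
  "matching_3graph t =
     \<lparr>verts = {..<3 * t}, edges = {{3 * j, 3 * j + 1, 3 * j + 2} | j. j < t}\<rparr>"

text \<open>This is used both for 3-graphs and for graphs (their links); for the latter, having no
  monochromatic edge means that the colouring is proper.\<close>

definition chromatic_number :: "'a hypergraph \<Rightarrow> nat" where
  "chromatic_number H = (LEAST k. \<exists>c :: 'a \<Rightarrow> nat. c ` verts H \<subseteq> {..<k} \<and>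
     (\<forall>e\<in>edges H. \<not> (\<exists>a. \<forall>x\<in>e. c x = a)))"

text \<open>A strong red-blue colouring is given by its set of red vertices.\<close>

definition strong_coloring :: "'a hypergraph \<Rightarrow> 'a set \<Rightarrow> bool" where
  "strong_coloring F R \<longleftrightarrow> R \<subseteq> verts F \<and> (\<forall>e\<in>edges F. card (e \<inter> R) = 1)"

text \<open>The infimum of the empty set is \<open>\<infinity>\<close> in \<^typ>\<open>enat\<close>.\<close>

definition strong_number :: "'a hypergraph \<Rightarrow> enat" where
  "strong_number F = (INF R\<in>{R. strong_coloring F R}. enat (card R))"

definition link_graph :: "'a hypergraph \<Rightarrow> 'a \<Rightarrow> 'a hypergraph" where
  "link_graph F v =
     \<lparr>verts = verts F - {v}, edges = {{x, y} | x y. {v, x, y} \<in> edges F}\<rparr>"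

text \<open>The \<open>i\<close>-th largest (counting from 1, with multiplicity) of the chromatic numbers of the
  links, that is, \<open>\<chi>(L\<^sub>F(i))\<close> when the vertices are ordered by non-increasing
  chromatic number of the link. It does not depend on how ties are broken.\<close>

definition link_chi :: "'a hypergraph \<Rightarrow> nat \<Rightarrow> nat" where
  "link_chi F i = rev (sorted_list_of_multiset
     (image_mset (\<lambda>v. chromatic_number (link_graph F v)) (mset_set (verts F)))) ! (i - 1)"

text \<open>The parts are the residue classes modulo \<open>k\<close>. Only \<open>k \<ge> 1\<close> is meaningful: since
  \<open>x mod 0 = x\<close>, the value at \<open>k = 0\<close> is the complete graph.\<close>

definition turan_graph :: "nat \<Rightarrow> nat \<Rightarrow> nat hypergraph" where
  "turan_graph m k =
     \<lparr>verts = {..<m}, edges = {{x, y} | x y. x < m \<and> y < m \<and> x mod k \<noteq> y mod k}\<rparr>"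

text \<open>The 3-graph \<open>H\<^sub>i\<close>, with \<open>A\<^sub>1 = {..<i - 1}\<close>, \<open>A\<^sub>2 = {i - 1..<s}\<close>, \<open>B = {s..<n}\<close>; the
  Turan graph is translated by \<open>s\<close> onto \<open>B\<close>. It is intended for \<open>1 \<le> i \<le> q(F) \<le> s \<le> n\<close>.
  If \<open>\<chi>(F) = 2\<close>, then \<^term>\<open>link_chi F i \<ge> 2\<close> for these \<open>i\<close>: the red vertices of a strong
  colouring with fewest red vertices are not isolated, so at least \<open>q(F)\<close> links have an edge.\<close>

definition gtz_graph :: "nat hypergraph \<Rightarrow> nat \<Rightarrow> nat \<Rightarrow> nat \<Rightarrow> nat hypergraph" where
  "gtz_graph F s n i =
     (let A1 = {..<i - 1}; A2 = {i - 1..<s}; B = {s..<n};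
          T = (\<lambda>e. (+) s ` e) ` edges (turan_graph (n - s) (link_chi F i - 1))
      in \<lparr>verts = A1 \<union> A2 \<union> B,
          edges = {{a, x, y} | a x y. a \<in> A1 \<and> x \<in> B \<and> y \<in> B \<and> x \<noteq> y} \<union>
                  {{a, x, y} | a x y. a \<in> A2 \<and> {x, y} \<in> T}\<rparr>)"

end

theory Submission imports Defs begin

text \<open>The prediction only looks at the links one at a time. Let \<open>F\<close> be a 3-graph that is not
  3-partite, although all of its links are bipartite and it has a strong colouring with two red
  vertices. Then every Turan graph in the definition of \<open>H\<^sub>i\<close> has a single part, so \<open>H\<^sub>i\<close>
  has at most \<open>(i - 1) n\<^sup>2 / 2 \<le> n\<^sup>2 / 2\<close> edges. On the other hand, the complete
  3-partite 3-graph with parts of sizes \<open>s\<close>, \<open>(n - s) / 2\<close> and \<open>(n - s) / 2\<close> contains neither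
  \<open>F\<close> nor \<open>s + 1\<close> disjoint edges, and it has about \<open>s n\<^sup>2 / 4\<close> edges, which is more as soon as
  \<open>s \<ge> 3\<close>. The 3-graphs \<open>F\<close> used here are a book with at least two pages, together with an edge
  joining two of its pages to a new vertex.\<close>

section \<open>Chromatic numbers and links\<close>

text \<open>\<open>S\<close> and its complement are the colour classes; a nonempty edge rules out
  fewer colours. Edges may have any size, so this serves 3-graphs and links alike.\<close>

lemma chromatic_number_eq_2I:
  assumes "e \<in> edges H" "e \<noteq> {}" "e \<subseteq> verts H"
    and "\<And>e. e \<in> edges H \<Longrightarrow> e \<inter> S \<noteq> {} \<and> \<not> e \<subseteq> S"
  shows "chromatic_number H = 2"
  unfolding chromatic_number_def
proof (rule Least_equality)
  let ?c = "\<lambda>x. if x \<in> S then 1 else 0 :: nat"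
  have "\<not> (\<exists>a. \<forall>x\<in>e. ?c x = a)" if "e \<in> edges H" for e
    using assms(4)[OF that] by (auto split: if_splits)
  then show "\<exists>c. c ` verts H \<subseteq> {..<2::nat} \<and> (\<forall>e\<in>edges H. \<not> (\<exists>a. \<forall>x\<in>e. c x = a))"
    by (intro exI[of _ ?c]) auto
next
  fix k :: nat
  assume "\<exists>c. c ` verts H \<subseteq> {..<k} \<and> (\<forall>e\<in>edges H. \<not> (\<exists>a. \<forall>x\<in>e. c x = a))"
  then obtain c where c: "c ` verts H \<subseteq> {..<k}" "\<forall>e\<in>edges H. \<not> (\<exists>a. \<forall>x\<in>e. c x = a)"
    by (elim exE conjE)
  show "2 \<le> k"
  proof (rule ccontr)
    assume "\<not> 2 \<le> k"
    then have "\<forall>x\<in>e. c x = 0" using c(1) assms(3) by fastforce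
    with c(2) assms(1) show False by blast
  qed
qed

text \<open>Edges of size 3 force \<open>x\<close> and \<open>y\<close> to differ from
  \<open>v\<close>, so link edges can be studied by cases on the edges of \<open>F\<close>.\<close>

lemma link_graph_edgeE:
  assumes "three_graph F" "f \<in> edges (link_graph F v)"
  obtains g where "g \<in> edges F" "v \<in> g" "f = g - {v}"
proof -
  obtain x y where xy: "f = {x, y}" "{v, x, y} \<in> edges F"
    using assms(2) by (auto simp: link_graph_def)
  then have "card {v, x, y} = 3" using assms(1) unfolding three_graph_def by blast
  then have "v \<noteq> x" "v \<noteq> y" by (auto simp: card_insert_if split: if_splits)
  then have "f = {v, x, y} - {v}" unfolding xy(1) by blast
  with xy(2) show ?thesis by (intro that[of "{v, x, y}"]) simp_all
qed

text \<open>The sorted list of link chromatic numbers is constant, so every valid index reads off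
  \<open>k\<close>.\<close>

lemma link_chi_eqI:
  assumes "\<And>v. v \<in> verts F \<Longrightarrow> chromatic_number (link_graph F v) = k"
    and "1 \<le> i" "i \<le> card (verts F)"
  shows "link_chi F i = k"
proof -
  let ?M = "image_mset (\<lambda>v. chromatic_number (link_graph F v)) (mset_set (verts F))"
  have fin: "finite (verts F)" using assms(2,3) by (metis card.infinite not_one_le_zero le_trans)
  let ?xs = "rev (sorted_list_of_multiset ?M)"
  have set: "set ?xs \<subseteq> {k}" using assms(1) fin by auto
  have "length ?xs = card (verts F)"
    by (metis length_rev size_mset mset_sorted_list_of_multiset size_image_mset size_mset_set)
  then have "?xs ! (i - 1) \<in> set ?xs" using assms(2,3) by (intro nth_mem) auto
  with set show ?thesis unfolding link_chi_def by blast
qed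

section \<open>Lower bounds for Turan numbers; matchings\<close>

lemma card_edges_le_turan_ex:
  fixes H :: "nat hypergraph"
  assumes "three_graph H" "card (verts H) = n" "\<And>F. F \<in> \<F> \<Longrightarrow> \<not> contains_copy H F"
  shows "card (edges H) \<le> turan_ex n \<F>"
  unfolding turan_ex_def
proof (rule Max_ge)
  show "finite {card (edges H) | H :: nat hypergraph. three_graph H \<and> card (verts H) = n \<and>
      (\<forall>F\<in>\<F>. \<not> contains_copy H F)}"
  \<comment> \<open>Infinitely many hosts \<open>H\<close> compete, but their edge counts are at
    most \<open>2 ^ n\<close>.\<close>
  proof (rule finite_subset)
    have "card (edges H) \<le> 2 ^ n" if "three_graph H" "card (verts H) = n" for H :: "nat hypergraph"
    proof -
      have "edges H \<subseteq> Pow (verts H)" "finite (verts H)"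
        using that(1) unfolding three_graph_def by auto
      then show ?thesis using that(2) by (metis card_Pow card_mono finite_Pow_iff)
    qed
    then show "{card (edges H) | H :: nat hypergraph. three_graph H \<and> card (verts H) = n \<and>
      (\<forall>F\<in>\<F>. \<not> contains_copy H F)} \<subseteq> {..2 ^ n}" by auto
  qed simp
  show "card (edges H) \<in> {card (edges H) | H :: nat hypergraph. three_graph H \<and>
      card (verts H) = n \<and> (\<forall>F\<in>\<F>. \<not> contains_copy H F)}"
    using assms by blast
qed

text \<open>Disjoint edges meet the cover \<open>A\<close> in distinct points, so there are at most
  \<open>card A\<close> of them.\<close>

lemma matching_free_if_covered:
  assumes "finite A" "card A \<le> s" "\<And>e. e \<in> edges H \<Longrightarrow> e \<inter> A \<noteq> {}"
  shows "\<not> contains_copy H (matching_3graph (s + 1))"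
proof
  assume "contains_copy H (matching_3graph (s + 1))"
  then obtain f where inj: "inj_on f {..<3 * (s + 1)}"
    and f: "\<forall>e\<in>{{3 * j, 3 * j + 1, 3 * j + 2} | j. j < s + 1}. f ` e \<in> edges H"
    unfolding contains_copy_def matching_3graph_def hypergraph.simps by blast
  have edge: "f ` {3 * j, 3 * j + 1, 3 * j + 2} \<in> edges H" if "j < s + 1" for j
    using that by (intro bspec[OF f]) blast
  \<comment> \<open>\<open>x div 3\<close> recovers the index of the matching edge containing
    \<open>x\<close>.\<close>
  have "\<exists>x. x div 3 = j \<and> f x \<in> A" if j: "j < s + 1" for j
  proof -
    obtain x where "x \<in> {3 * j, 3 * j + 1, 3 * j + 2}" "f x \<in> A"
      using assms(3)[OF edge[OF j]] by blast
    then show ?thesis by (intro exI[of _ x]) auto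
  qed
  then obtain g where g: "\<And>j. j < s + 1 \<Longrightarrow> g j div 3 = j \<and> f (g j) \<in> A" by metis
  have "inj_on (\<lambda>j. f (g j)) {..<s + 1}"
  proof (rule inj_onI)
    fix i j assume ij: "i \<in> {..<s + 1}" "j \<in> {..<s + 1}" "f (g i) = f (g j)"
    have "g i div 3 < s + 1" "g j div 3 < s + 1" using g ij(1,2) by auto
    then have "g i \<in> {..<3 * (s + 1)}" "g j \<in> {..<3 * (s + 1)}" by auto
    then have "g i = g j" using inj_onD[OF inj ij(3)] by blast
    then show "i = j" using g ij(1,2) by (metis lessThan_iff)
  qed
  then have "card {..<s + 1} \<le> card A"
    using g assms(1) by (intro card_inj_on_le) auto
  then show False using assms(2) by simp
qed

section \<open>Complete 3-partite hosts\<close>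

text \<open>Stated through images of edges, such colourings pull back along copies by mere
  composition.\<close>

definition tripartite :: "'a hypergraph \<Rightarrow> bool" where
  "tripartite H \<longleftrightarrow> (\<exists>c :: 'a \<Rightarrow> nat. \<forall>e\<in>edges H. c ` e = {0, 1, 2})"

lemma tripartite_if_contains_copy:
  assumes "contains_copy H F" "tripartite H"
  shows "tripartite F"
proof -
  obtain f c where "\<forall>e\<in>edges F. f ` e \<in> edges H" "\<forall>e\<in>edges H. c ` e = {0, 1, 2::nat}"
    using assms unfolding contains_copy_def tripartite_def by metis
  then have "\<forall>e\<in>edges F. (c \<circ> f) ` e = {0, 1, 2}" by (metis image_comp)
  then show ?thesis unfolding tripartite_def by blast
qed

text \<open>The classes are the first \<open>s\<close> vertices and the rest split by the parity of
  the offset from \<open>s\<close>. If \<open>n - s\<close> is odd, the last vertex is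
  isolated.\<close>

definition tripartite_host :: "nat \<Rightarrow> nat \<Rightarrow> nat hypergraph" where
  "tripartite_host s n =
     \<lparr>verts = {..<n},
      edges = (\<lambda>(a, p, q). {a, s + 2 * p, s + 2 * q + 1}) `
        ({..<s} \<times> {..<(n - s) div 2} \<times> {..<(n - s) div 2})\<rparr>"

lemma three_graph_tripartite_host: "three_graph (tripartite_host s n)"
proof -
  have "card {a, s + 2 * p, s + 2 * q + 1} = 3" if "a < s" for a p q
  proof -
    have "s + 2 * p \<noteq> s + 2 * q + 1" by presburger
    then show ?thesis using that by simp
  qed
  then show ?thesis unfolding three_graph_def tripartite_host_def by fastforce
qed

lemma tripartite_tripartite_host: "tripartite (tripartite_host s n)"
  unfolding tripartite_def tripartite_host_def
  by (rule exI[of _ "\<lambda>x. if x < s then 0 else if even (x - s) then 1 else 2"]) auto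

lemma card_edges_tripartite_host:
  "card (edges (tripartite_host s n)) = s * ((n - s) div 2)\<^sup>2"
proof -
  \<comment> \<open>The bound \<open>a < s\<close> and the parity of the offset from
    \<open>s\<close> tell the three vertices of an edge apart.\<close>
  have key: "a = a' \<and> p = p' \<and> q = q'"
    if "a < s" "a' < s" "{a, s + 2 * p, s + 2 * q + 1} = {a', s + 2 * p', s + 2 * q' + 1}"
    for a p q a' p' q'
  proof -
    have "a \<in> {a', s + 2 * p', s + 2 * q' + 1}" "s + 2 * p \<in> {a', s + 2 * p', s + 2 * q' + 1}"
      "s + 2 * q + 1 \<in> {a', s + 2 * p', s + 2 * q' + 1}"
      unfolding that(3)[symmetric] by simp_all
    moreover have "s + 2 * p \<noteq> s + 2 * q' + 1" "s + 2 * q + 1 \<noteq> s + 2 * p'" by presburger+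
    ultimately show ?thesis using that(1,2) by auto
  qed
  have "inj_on (\<lambda>(a, p, q). {a, s + 2 * p, s + 2 * q + 1})
      ({..<s} \<times> {..<(n - s) div 2} \<times> {..<(n - s) div 2})" (is "inj_on ?f ?A")
  proof (rule inj_onI)
    fix t t' assume t: "t \<in> ?A" "t' \<in> ?A" "?f t = ?f t'"
    obtain a p q a' p' q' where eq: "t = (a, p, q)" "t' = (a', p', q')" by (metis prod_cases3)
    have "a < s" "a' < s" using t(1,2) unfolding eq by simp_all
    moreover have "{a, s + 2 * p, s + 2 * q + 1} = {a', s + 2 * p', s + 2 * q' + 1}"
      using t(3) unfolding eq prod.case .
    ultimately show "t = t'" unfolding eq using key by blast
  qed
  then show ?thesis
    by (simp add: tripartite_host_def card_image power2_eq_square)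
qed

text \<open>The host is tripartite, which excludes \<open>F\<close>, and its class
  \<open>{..<s}\<close> meets every edge, which excludes the matching.\<close>

lemma turan_ex_ge_if_not_tripartite:
  assumes "\<not> tripartite F"
  shows "s * ((n - s) div 2)\<^sup>2 \<le> turan_ex n {F, matching_3graph (s + 1)}"
proof -
  have "\<not> contains_copy (tripartite_host s n) F"
    using assms tripartite_if_contains_copy tripartite_tripartite_host by blast
  moreover have "\<not> contains_copy (tripartite_host s n) (matching_3graph (s + 1))"
    by (rule matching_free_if_covered[of "{..<s}"]) (auto simp: tripartite_host_def)
  ultimately have "card (edges (tripartite_host s n)) \<le> turan_ex n {F, matching_3graph (s + 1)}"
    by (intro card_edges_le_turan_ex[OF three_graph_tripartite_host])
      (auto simp: tripartite_host_def)
  then show ?thesis by (simp add: card_edges_tripartite_host)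
qed

section \<open>Comparison with the prediction\<close>

text \<open>The Turan graph has \<open>2 - 1 = 1\<close> part, hence no edges; only the edges
  through \<open>A1\<close> remain.\<close>

lemma card_edges_gtz_graph_le:
  assumes "link_chi F i = 2"
  shows "card (edges (gtz_graph F s n i)) \<le> (i - 1) * ((n - s) choose 2)"
proof -
  let ?P = "{..<i - 1} \<times> {K. K \<subseteq> {s..<n} \<and> card K = 2}"
  have fin: "finite ?P" by auto
  have "edges (gtz_graph F s n i) \<subseteq> (\<lambda>(a, K). insert a K) ` ?P"
  proof
    fix e assume "e \<in> edges (gtz_graph F s n i)"
    then obtain a x y where "e = {a, x, y}" "a < i - 1" "x \<in> {s..<n}" "y \<in> {s..<n}" "x \<noteq> y"
      using assms by (auto simp: gtz_graph_def turan_graph_def Let_def)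
    then show "e \<in> (\<lambda>(a, K). insert a K) ` ?P"
      by (intro image_eqI[of _ _ "(a, {x, y})"]) auto
  qed
  then have "card (edges (gtz_graph F s n i)) \<le> card ?P"
    using fin by (meson card_image_le card_mono finite_imageI le_trans)
  also have "\<dots> = (i - 1) * ((n - s) choose 2)"
    by (simp add: card_cartesian_product n_subsets)
  finally show ?thesis .
qed

text \<open>For \<open>s = 4\<close> the host has about \<open>n\<^sup>2\<close> edges, while
  \<open>i \<le> 2\<close> leaves at most one vertex in \<open>A1\<close> and so at most
  \<open>n\<^sup>2 / 2\<close> predicted edges.\<close>

lemma gtz_fails_if_not_tripartite:
  assumes "\<not> tripartite F" "0 < strong_number F" "strong_number F \<le> 2" "2 \<le> card (verts F)"
    and links: "\<And>v. v \<in> verts F \<Longrightarrow> chromatic_number (link_graph F v) = 2"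
  shows "(\<lambda>n. real (turan_ex n {F, matching_3graph (4 + 1)}) -
            real (Max {card (edges (gtz_graph F 4 n i)) | i. 1 \<le> i \<and> enat i \<le> strong_number F}))
         \<notin> o(\<lambda>n. (real n)\<^sup>2)"
    (is "?D \<notin> _")
proof
  have lower: "(real n)\<^sup>2 / 4 \<le> ?D n" if "40 \<le> n" for n
  proof -
    let ?S = "{card (edges (gtz_graph F 4 n i)) | i. 1 \<le> i \<and> enat i \<le> strong_number F}"
    have i_le: "i \<le> 2" if "enat i \<le> strong_number F" for i
      using order_trans[OF that assms(3)] by (simp add: numeral_eq_enat)
    have "?S \<subseteq> (\<lambda>i. card (edges (gtz_graph F 4 n i))) ` {..2}" using i_le by auto
    then have fin: "finite ?S" by (rule finite_subset) simp
    have "enat 1 \<le> strong_number F"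
      using assms(2) by (metis ileI1 eSuc_enat one_enat_def one_eSuc zero_enat_def)
    then have ne: "?S \<noteq> {}" by blast
    have "Max ?S \<le> (n - 4) choose 2"
    proof (rule Max.boundedI[OF fin ne])
      fix k assume "k \<in> ?S"
      then obtain i where i: "k = card (edges (gtz_graph F 4 n i))" "1 \<le> i" "i \<le> 2"
        using i_le by blast
      have "link_chi F i = 2" using links i(2,3) assms(4) by (intro link_chi_eqI) auto
      then have "k \<le> (i - 1) * ((n - 4) choose 2)" unfolding i(1) by (rule card_edges_gtz_graph_le)
      also have "\<dots> \<le> 1 * ((n - 4) choose 2)" using i(3) by (intro mult_right_mono) auto
      finally show "k \<le> (n - 4) choose 2" by simp
    qed
    moreover have "2 * ((n - 4) choose 2) \<le> n\<^sup>2"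
    proof -
      have "2 * ((n - 4) choose 2) \<le> (n - 4) * (n - 4 - 1)" by (simp only: choose_two)
      also have "\<dots> \<le> n * n" by (intro mult_le_mono) auto
      finally show ?thesis by (simp add: power2_eq_square)
    qed
    ultimately have upper: "real (Max ?S) \<le> (real n)\<^sup>2 / 2"
      using of_nat_mono[of "2 * Max ?S" "n\<^sup>2", where 'a=real] by simp
    have "4 * (real ((n - 4) div 2))\<^sup>2 \<le> real (turan_ex n {F, matching_3graph (4 + 1)})"
      using of_nat_mono[OF turan_ex_ge_if_not_tripartite[OF assms(1), of 4 n], where 'a=real] by simp
    \<comment> \<open>Rounding down costs at most one: \<open>2 * ((n - 4) div 2)\<close> is at
      least \<open>n - 5\<close>.\<close>
    moreover have "(real n - 5)\<^sup>2 \<le> (2 * real ((n - 4) div 2))\<^sup>2"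
      using that by (intro power_mono) linarith+
    moreover have "3 / 4 * (real n)\<^sup>2 \<le> (real n - 5)\<^sup>2"
    proof -
      \<comment> \<open>The claim amounts to \<open>10 * n \<le> n\<^sup>2 / 4 + 25\<close>, which
        is where \<open>40\<close> comes from.\<close>
      have "40 * real n \<le> real n * real n" using that by (intro mult_right_mono) auto
      then show ?thesis by (simp add: power2_eq_square algebra_simps)
    qed
    ultimately show ?thesis using upper by (simp add: power_mult_distrib)
  qed
  assume "?D \<in> o(\<lambda>n. (real n)\<^sup>2)"
  \<comment> \<open>Any constant below the \<open>1 / 4\<close> of \<open>lower\<close> yields a
    contradiction.\<close>
  then have "eventually (\<lambda>n. norm (?D n) \<le> 1 / 8 * norm ((real n)\<^sup>2)) sequentially"
    by (rule landau_o.smallD) simp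
  then obtain N where N: "\<And>n. N \<le> n \<Longrightarrow> norm (?D n) \<le> 1 / 8 * norm ((real n)\<^sup>2)"
    unfolding eventually_sequentially by blast
  define n where "n = max N 40"
  have "(real n)\<^sup>2 / 4 \<le> ?D n" "norm (?D n) \<le> 1 / 8 * (real n)\<^sup>2"
    using lower[of n] N[of n] by (simp_all add: n_def)
  moreover have "0 < (real n)\<^sup>2" by (simp add: n_def)
  ultimately show False by simp
qed

section \<open>Closed books\<close>

text \<open>The spine of the book is \<open>{0, 1}\<close>, the pages are \<open>3, \<dots>, N - 1\<close>, and the extra edge joins the
  pages \<open>3\<close> and \<open>4\<close> to the new vertex \<open>2\<close>.\<close>

definition closed_book :: "nat \<Rightarrow> nat hypergraph" where
  "closed_book N =
     \<lparr>verts = {..<N}, edges = insert {2, 3, 4} {{0, 1, j} | j. 3 \<le> j \<and> j < N}\<rparr>"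

lemma verts_closed_book [simp]: "verts (closed_book N) = {..<N}"
  by (simp add: closed_book_def)

lemma edges_closed_bookE:
  assumes "e \<in> edges (closed_book N)"
  obtains "e = {2, 3, 4}" | j where "e = {0, 1, j}" "3 \<le> j" "j < N"
  using assms unfolding closed_book_def hypergraph.simps by blast

lemma three_graph_closed_book:
  assumes "5 \<le> N"
  shows "three_graph (closed_book N)"
  unfolding three_graph_def
proof (intro conjI ballI)
  fix e assume "e \<in> edges (closed_book N)"
  then have "e \<subseteq> {..<N} \<and> card e = 3"
    by (rule edges_closed_bookE) (use assms in simp_all)
  then show "e \<subseteq> verts (closed_book N)" "card e = 3" by simp_all
qed simp

text \<open>Pages \<open>3\<close> and \<open>4\<close> both take the colour missing from the spine,
  yet the edge \<open>{2, 3, 4}\<close> must separate them.\<close>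

lemma not_tripartite_closed_book:
  assumes "5 \<le> N"
  shows "\<not> tripartite (closed_book N)"
proof
  assume "tripartite (closed_book N)"
  then obtain c where c: "\<And>e. e \<in> edges (closed_book N) \<Longrightarrow> c ` e = {0, 1, 2 :: nat}"
    unfolding tripartite_def by metis
  have "{0, 1, 3} \<in> edges (closed_book N)" "{0, 1, 4} \<in> edges (closed_book N)"
    using assms by (auto simp: closed_book_def)
  from this[THEN c] have "{c 0, c 1, c 3} = {0, 1, 2}" "{c 0, c 1, c 4} = {0, 1, 2}" by simp_all
  \<comment> \<open>The three colours sum to 3, so two of them determine the third.\<close>
  moreover have "z = 3 - x - y" if "{x, y, z} = {0, 1, 2}" for x y z :: nat
  proof -
    have "card {x, y, z} = 3" unfolding that by simp
    then have "x \<noteq> y" "x \<noteq> z" "y \<noteq> z" by (auto simp: card_insert_if split: if_splits)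
    then have "x + y + z = \<Sum>{x, y, z}" by simp
    also have "\<dots> = 3" unfolding that by simp
    finally show ?thesis by simp
  qed
  ultimately have "c 3 = c 4" by metis
  have "{2, 3, 4} \<in> edges (closed_book N)" by (simp add: closed_book_def)
  from c[OF this] have "{c 2, c 4} = {0, 1, 2}" using \<open>c 3 = c 4\<close> by simp
  then have "card {c 2, c 4} = 3" by simp
  then show False using card_insert_le_m1[of 2 "{c 4}" "c 2"] by simp
qed

lemma strong_coloring_closed_book:
  assumes "5 \<le> N"
  shows "strong_coloring (closed_book N) {0, 2}"
  unfolding strong_coloring_def
proof (intro conjI ballI)
  fix e assume "e \<in> edges (closed_book N)"
  then show "card (e \<inter> {0, 2}) = 1"
    by (rule edges_closed_bookE) simp_all
qed (use assms in simp)

text \<open>The edge \<open>{2, 3, 4}\<close> needs a red vertex, and the red set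
  \<open>{0, 2}\<close> gives the upper bound.\<close>

lemma strong_number_closed_book:
  assumes "5 \<le> N"
  shows "0 < strong_number (closed_book N)" "strong_number (closed_book N) \<le> 2"
proof -
  have "1 \<le> strong_number (closed_book N)"
    unfolding strong_number_def
  proof (rule INF_greatest)
    fix R assume "R \<in> {R. strong_coloring (closed_book N) R}"
    then have "R \<subseteq> {..<N}" "card ({2, 3, 4} \<inter> R) = 1"
      by (auto simp: strong_coloring_def closed_book_def)
    then have "finite R" "R \<noteq> {}" by (auto intro: finite_subset)
    then have "1 \<le> card R" by (simp add: Suc_leI card_gt_0_iff)
    then show "1 \<le> enat (card R)" by (simp add: one_enat_def)
  qed
  then show "0 < strong_number (closed_book N)"
    by (metis iless_eSuc0 not_less one_eSuc not_one_le_zero not_gr_zero)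
  have "strong_number (closed_book N) \<le> enat (card {0, 2 :: nat})"
    unfolding strong_number_def by (rule INF_lower) (simp add: strong_coloring_closed_book assms)
  then show "strong_number (closed_book N) \<le> 2" by (simp add: numeral_eq_enat numeral_2_eq_2)
qed

text \<open>The red set of a strong colouring is a colour class of a proper 2-colouring.\<close>

lemma chromatic_number_closed_book:
  assumes "5 \<le> N"
  shows "chromatic_number (closed_book N) = 2"
proof (rule chromatic_number_eq_2I)
  show "{2, 3, 4} \<in> edges (closed_book N)" "{2, 3, 4} \<subseteq> verts (closed_book N)"
    using assms by (auto simp: closed_book_def)
  fix e assume "e \<in> edges (closed_book N)"
  then show "e \<inter> {0, 2} \<noteq> {} \<and> \<not> e \<subseteq> {0, 2}"
    by (rule edges_closed_bookE) simp_all
qed simp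

lemma chromatic_number_link_closed_book:
  assumes "5 \<le> N" "v \<in> verts (closed_book N)"
  shows "chromatic_number (link_graph (closed_book N) v) = 2"
proof -
  \<comment> \<open>The links of \<open>0\<close> and \<open>1\<close> are stars centred at
    \<open>1\<close> and \<open>0\<close>; that of \<open>2\<close> is the edge
    \<open>{3, 4}\<close>; any other consists of \<open>{0, 1}\<close> and, for \<open>3\<close> and
    \<open>4\<close>, a disjoint edge through \<open>2\<close>. \<open>S\<close> is a colour class
    and \<open>e\<close> an edge of the link.\<close>
  define S :: "nat set" where
    "S = (if v = 0 then {1} else if v = 1 then {0} else if v = 2 then {3} else {0, 2})"
  define e :: "nat set" where
    "e = (if v = 0 then {1, 3} else if v = 1 then {0, 3} else if v = 2 then {3, 4} else {0, 1})"
  have "e \<in> edges (link_graph (closed_book N) v)"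
  proof -
    have link: "{x, y} \<in> edges (link_graph (closed_book N) v)"
      if "{v, x, y} = f" "f \<in> edges (closed_book N)" for x y f
      using that unfolding link_graph_def by auto
    have page: "{0, 1, j} \<in> edges (closed_book N)" if "3 \<le> j" "j < N" for j
      using that by (auto simp: closed_book_def)
    have extra: "{2, 3, 4} \<in> edges (closed_book N)" by (simp add: closed_book_def)
    consider "v = 0" | "v = 1" | "v = 2" | "3 \<le> v" "v < N"
      using assms by (force simp: closed_book_def)
    then show ?thesis
    proof cases
      case 1
      then show ?thesis using link[of 1 3, OF _ page[of 3]] assms(1) by (simp add: e_def)
    next
      case 2
      then have "{v, 0, 3} = {0, 1, 3}" by auto
      with 2 show ?thesis using link[of 0 3, OF _ page[of 3]] assms(1) by (simp add: e_def)
    next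
      case 3
      then show ?thesis using link[of 3 4, OF _ extra] by (simp add: e_def)
    next
      case 4
      have "{v, 0, 1} = {0, 1, v}" by auto
      with 4 show ?thesis using link[of 0 1, OF _ page[of v]] by (simp add: e_def)
    qed
  qed
  moreover have "e \<noteq> {}" "e \<subseteq> verts (link_graph (closed_book N) v)"
    using assms by (auto simp: e_def link_graph_def closed_book_def)
  moreover have "f \<inter> S \<noteq> {} \<and> \<not> f \<subseteq> S"
    if f: "f \<in> edges (link_graph (closed_book N) v)" for f
  proof -
    obtain g where g: "g \<in> edges (closed_book N)" "v \<in> g" "f = g - {v}"
      using link_graph_edgeE[OF three_graph_closed_book[OF assms(1)] f] .
    from g(1) show ?thesis
    proof (cases rule: edges_closed_bookE)
      case 1
      with g(2) have "v = 2 \<or> v = 3 \<or> v = 4" by simp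
      then show ?thesis unfolding g(3) 1 by (elim disjE) (simp_all add: S_def insert_Diff_if)
    next
      case (2 j)
      with g(2) have "v = 0 \<or> v = 1 \<or> v = j" by simp
      then show ?thesis using 2(2) unfolding g(3) 2(1)
        by (elim disjE) (simp_all add: S_def insert_Diff_if)
    qed
  qed
  ultimately show ?thesis by (rule chromatic_number_eq_2I)
qed

section \<open>The infinite family\<close>

lemma hg_isomorphic_closed_bookD:
  assumes "hg_isomorphic (closed_book M) (closed_book N)"
  shows "M = N"
proof -
  obtain f where "bij_betw f {..<M} {..<N}"
    using assms unfolding hg_isomorphic_def closed_book_def by auto
  from bij_betw_same_card[OF this] show ?thesis by simp
qed

theorem corollary1p6:
  "\<exists>\<F> :: nat hypergraph set.
     infinite \<F> \<and>
     pairwise (\<lambda>F G. \<not> hg_isomorphic F G) \<F> \<and>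
     (\<forall>F\<in>\<F>. three_graph F \<and> chromatic_number F = 2 \<and> strong_number F < \<infinity> \<and>
       (\<exists>s::nat. strong_number F \<le> enat s \<and>
         (\<lambda>n::nat. real (turan_ex n {F, matching_3graph (s + 1)}) -
            real (Max {card (edges (gtz_graph F s n i)) | i::nat.
                         1 \<le> i \<and> enat i \<le> strong_number F}))
         \<notin> o(\<lambda>n. (real n)\<^sup>2)))"
\<comment> \<open>From \<open>5\<close> on both pages \<open>3\<close> and \<open>4\<close> exist;
  the members differ in their number of vertices.\<close>
proof (intro exI[of _ "closed_book ` {5..}"] conjI ballI)
  have "inj_on closed_book {5..}"
    by (rule inj_onI) (drule arg_cong[of _ _ verts], simp)
  then show "infinite (closed_book ` {5..})" by (simp add: finite_image_iff infinite_Ici)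
  show "pairwise (\<lambda>F G. \<not> hg_isomorphic F G) (closed_book ` {5..})"
    unfolding pairwise_def using hg_isomorphic_closed_bookD by blast
next
  fix F assume "F \<in> closed_book ` {5..}"
  then obtain N where N: "5 \<le> N" "F = closed_book N" by auto
  note q = strong_number_closed_book[OF N(1)]
  show "three_graph F" "chromatic_number F = 2"
    using N three_graph_closed_book chromatic_number_closed_book by auto
  have "strong_number F \<le> enat 2" using q(2) N(2) by (simp add: numeral_eq_enat)
  then show "strong_number F < \<infinity>" using enat_ord_simps(4) le_less_trans by blast
  from \<open>strong_number F \<le> enat 2\<close> have "strong_number F \<le> enat 4"
    by (rule order_trans) simp
  moreover have "(\<lambda>n. real (turan_ex n {F, matching_3graph (4 + 1)}) -
      real (Max {card (edges (gtz_graph F 4 n i)) | i. 1 \<le> i \<and> enat i \<le> strong_number F}))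
      \<notin> o(\<lambda>n. (real n)\<^sup>2)"
    unfolding N(2)
    by (rule gtz_fails_if_not_tripartite[OF not_tripartite_closed_book[OF N(1)] q _
          chromatic_number_link_closed_book[OF N(1)]])
      (use N(1) in \<open>simp_all add: closed_book_def\<close>)
  ultimately show "\<exists>s::nat. strong_number F \<le> enat s \<and>
      (\<lambda>n::nat. real (turan_ex n {F, matching_3graph (s + 1)}) -
         real (Max {card (edges (gtz_graph F s n i)) | i::nat.
                      1 \<le> i \<and> enat i \<le> strong_number F}))
      \<notin> o(\<lambda>n. (real n)\<^sup>2)" by blast
qed

end
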